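(* Consider the map $\pi:\mathrm{End}(V)\to \mathrm{Sym}^2_{\ge 0}$, $U\mapsto \Sigma=U^TU$ (in indices, $\Sigma_{ab}=U_a^iC_{ij}U_b^j$). Then the Euclidean gradient flow on $\mathrm{End}(V)$ for the functional $J(U,\lambda)$, $$\frac{dU_a^i}{dt}=-\frac14\, C_{ac}\,C^{ij}\,(DJ(U,\lambda))^c_j=-\frac14\, C_{ac}\,C^{ij}\,\frac{\partial J(U,\lambda)}{\partial U^j_c},$$ is a lift of the Riemannian gradient flow $$\frac{d\Sigma_{ab}}{dt}=-\frac12\left(\Sigma_{ac}C_{bd}(D\mathcal J)^{cd}+\Sigma_{bd}C_{ac}(D\mathcal J)^{cd}\right)$$ on $\mathrm{Sym}^2_{\ge0}$; that is, if $U(t)$ solves the first flow then $\Sigma(t)=\pi(U(t))$ solves the second.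
   Context: $V$ is a real $d$-dimensional vector space with dual $V^*$, and $\lambda>0$ is fixed. $X$ is a $V$-valued random variable and $Y$ a complex-valued random variable with $\mathbb E[|Y|^2]+\mathbb E[|X|^8]<\infty$. The covariance $\mathrm{Cov}(X)(\omega,\omega)=\mathbb E[\langle\omega,X-\mathbb E[X]\rangle^2]$ is an inner product on $V^*$, with matrix $C^{ij}$; the inverse matrix $C_{ij}$ defines the inner product $|\cdot|_V^2=(\cdot,\cdot)_V$ on $V$ (the inverse covariance). Adjoints $U^T$ are taken with respect to $(\cdot,\cdot)_V$. Summation over repeated indices is understood; $U\in \mathrm{End}(V)$ has components $U^i_a$, $(Ux)^i=U^i_ax^a$. Kernel: $k_V:V^*\to(0,\infty)$ is rotationally invariant, i.e. a function of the dual norm $|\omega|_V^2$, with $\int_{V^*}k_V\,d\omega=1$. $K(x)=\int_{V^*}e^{2\pi i\langle x,\omega\rangle}k_V(\omega)d\omega=\mathcal K(|x|_V^2)$, where $\mathcal K',\mathcal K'':[0,\infty)\to\mathbb R$ are bounded continuous and $r\mathcal K'(r)$ is bounded for large $r$. $\mathcal H$ is the Hilbert space of functions $f(x)=\int_{V^*}\hat f(\omega)e^{2\pi i\langle\omega,x\rangle}d\omega$ on $V$ with $\|f\|_{\mathcal H}^2=\int_{V^*}|\hat f|^2/k_V\,d\omega<\infty$. For $U\in\mathrm{End}(V)$: $J(U,\lambda)=\inf_{f\in\mathcal H}\{\frac12\mathbb E[|Y-f(UX)|^2]+\frac\lambda2\|f\|_{\mathcal H}^2\}$. $\mathrm{Sym}^2_+\subset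 \mathrm{Sym}^2V^*$ is the open set of positive definite inner products on $V$ and $\mathrm{Sym}^2_{\ge0}$ the closed set of positive semi-definite forms. For $\Sigma\in\mathrm{Sym}^2_{\ge0}$, $\mathcal J(\Sigma;\lambda):=J(U,\lambda)$ for any $U$ with $|x|_\Sigma^2=|Ux|_V^2$, i.e. $\Sigma=U^TU$ (by rotational invariance this depends only on $\Sigma$). Known background: $\mathcal J$ is $C^1$ on $\mathrm{Sym}^2_{\ge0}$, meaning there is a continuous $D\mathcal J:\mathrm{Sym}^2_{\ge0}\to\mathrm{Sym}^2V$ with $\mathcal J(\Sigma';\lambda)=\mathcal J(\Sigma;\lambda)+\langle D\mathcal J(\Sigma;\lambda),\Sigma'-\Sigma\rangle+o(|\Sigma'-\Sigma|)$ for $\Sigma,\Sigma'\in\mathrm{Sym}^2_{\ge0}$; moreover $D\mathcal J$ extends to a Lipschitz function on $\mathrm{Sym}^2V^*$. The differential of $J$ is written $DJ=(DJ)^c_j\,dU^j_c$. On $\mathrm{Sym}^2_+$ the Riemannian gradient flow is the downward gradient flow of $\mathcal J$ for the Riemannian metric given on cotangent vectors $A,A'\in T^*_\Sigma\mathrm{Sym}^2_+\simeq\mathrm{Sym}^2V$ by $\mathfrak g(A,A')=\frac12\Sigma_{ab}C_{cd}A^{ac}A'^{bd}+\frac12\Sigma_{ab}C_{cd}A^{bd}A'^{ac}$; it is given by the displayed ODE, which also makes sense on $\mathrm{Sym}^2_{\ge 0}$. *)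

theory Defs
  imports "HOL-Probability.Probability"
begin

text \<open>
  A basis of \<open>V\<close> is fixed, so \<open>V\<close> and its dual are both \<open>real ^ 'n\<close>, paired by the standard
  inner product; elements of \<open>End(V)\<close>, \<open>Sym\<^sup>2 V\<close> and \<open>Sym\<^sup>2 V\<^sup>*\<close> are matrices. The entry
  \<open>U $ i $ a\<close> of an endomorphism is its component with upper index \<open>i\<close> and lower index \<open>a\<close>.
\<close>

definition cov_form :: "'w measure \<Rightarrow> ('w \<Rightarrow> real ^ 'n) \<Rightarrow> real ^ 'n \<Rightarrow> real" where
  "cov_form M X \<omega> = (LINT w|M. (\<omega> \<bullet> (X w - (LINT v|M. X v)))\<^sup>2)"

definition cov_mat :: "'w measure \<Rightarrow> ('w \<Rightarrow> real ^ 'n) \<Rightarrow> real ^ 'n ^ 'n" where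
  "cov_mat M X = (\<chi> i j. LINT w|M. (X w - (LINT v|M. X v)) $ i * (X w - (LINT v|M. X v)) $ j)"

definition normV_sq :: "real ^ 'n ^ 'n \<Rightarrow> real ^ 'n \<Rightarrow> real" where
  "normV_sq C x = x \<bullet> (matrix_inv C *v x)"

definition dual_norm_sq :: "real ^ 'n ^ 'n \<Rightarrow> real ^ 'n \<Rightarrow> real" where
  "dual_norm_sq C \<omega> = \<omega> \<bullet> (C *v \<omega>)"

definition fourier_synth :: "(real ^ 'n \<Rightarrow> complex) \<Rightarrow> real ^ 'n \<Rightarrow> complex" where
  "fourier_synth g x = (LINT \<omega>|lborel. g \<omega> * cis (2 * pi * (\<omega> \<bullet> x)))"

text \<open>\<open>g\<close> is the transform of the element \<open>f\<close> of the Hilbert space with spectral density \<open>k\<close>.\<close>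

definition is_transform ::
  "(real ^ 'n \<Rightarrow> real) \<Rightarrow> (real ^ 'n \<Rightarrow> complex) \<Rightarrow> (real ^ 'n \<Rightarrow> complex) \<Rightarrow> bool" where
  "is_transform k f g \<longleftrightarrow> g \<in> borel_measurable lborel \<and>
     integrable lborel (\<lambda>\<omega>. (cmod (g \<omega>))\<^sup>2 / k \<omega>) \<and> f = fourier_synth g"

definition hilb :: "(real ^ 'n \<Rightarrow> real) \<Rightarrow> (real ^ 'n \<Rightarrow> complex) set" where
  "hilb k = {f. \<exists>g. is_transform k f g}"

text \<open>The transform of \<open>f\<close> is unique up to null sets, so the value below is well defined.\<close>

definition hilb_norm_sq :: "(real ^ 'n \<Rightarrow> real) \<Rightarrow> (real ^ 'n \<Rightarrow> complex) \<Rightarrow> real" where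
  "hilb_norm_sq k f =
     (THE r. \<exists>g. is_transform k f g \<and> r = (LINT \<omega>|lborel. (cmod (g \<omega>))\<^sup>2 / k \<omega>))"

definition J_fun :: "'w measure \<Rightarrow> ('w \<Rightarrow> real ^ 'n) \<Rightarrow> ('w \<Rightarrow> complex) \<Rightarrow> (real ^ 'n \<Rightarrow> real)
    \<Rightarrow> real \<Rightarrow> real ^ 'n ^ 'n \<Rightarrow> real" where
  "J_fun M X Y k lam U =
     (INF f\<in>hilb k. 1/2 * (LINT w|M. (cmod (Y w - f (U *v X w)))\<^sup>2) + lam/2 * hilb_norm_sq k f)"

definition Sym_ge0 :: "(real ^ 'n ^ 'n) set" where
  "Sym_ge0 = {S. transpose S = S \<and> (\<forall>x. 0 \<le> x \<bullet> (S *v x))}"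

text \<open>The form \<open>\<Sigma>(x, y) = (U x, U y)\<^sub>V\<close>, where \<open>( , )\<^sub>V\<close> has matrix \<open>matrix_inv C\<close>.\<close>

definition proj :: "real ^ 'n ^ 'n \<Rightarrow> real ^ 'n ^ 'n \<Rightarrow> real ^ 'n ^ 'n" where
  "proj C U = transpose U ** matrix_inv C ** U"

text \<open>By rotational invariance the value does not depend on the chosen \<open>U\<close>.\<close>

definition JJ_fun :: "'w measure \<Rightarrow> ('w \<Rightarrow> real ^ 'n) \<Rightarrow> ('w \<Rightarrow> complex) \<Rightarrow> (real ^ 'n \<Rightarrow> real)
    \<Rightarrow> real \<Rightarrow> real ^ 'n ^ 'n \<Rightarrow> real" where
  "JJ_fun M X Y k lam S = J_fun M X Y k lam
     (SOME U. \<forall>x. x \<bullet> (S *v x) = normV_sq (cov_mat M X) (U *v x))"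

definition pairing :: "real ^ 'n ^ 'n \<Rightarrow> real ^ 'n ^ 'n \<Rightarrow> real" where
  "pairing A H = (\<Sum>a\<in>UNIV. \<Sum>b\<in>UNIV. A $ a $ b * H $ a $ b)"

definition C1_differential ::
  "(real ^ 'n ^ 'n \<Rightarrow> real) \<Rightarrow> (real ^ 'n ^ 'n \<Rightarrow> real ^ 'n ^ 'n) \<Rightarrow> bool" where
  "C1_differential F DF \<longleftrightarrow> continuous_on Sym_ge0 DF \<and>
     (\<forall>S\<in>Sym_ge0. transpose (DF S) = DF S \<and>
        (F has_derivative (\<lambda>H. pairing (DF S) H)) (at S within Sym_ge0))"

text \<open>
  The coefficient of \<open>dU $ j $ c\<close> in the differential of \<open>F\<close>; \<open>axis j (axis c 1)\<close> is the matrix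
  unit with entry 1 in row \<open>j\<close>, column \<open>c\<close>.
\<close>

definition D_comp :: "(real ^ 'n ^ 'n \<Rightarrow> real) \<Rightarrow> real ^ 'n ^ 'n \<Rightarrow> 'n \<Rightarrow> 'n \<Rightarrow> real" where
  "D_comp F U c j = frechet_derivative F (at U) (axis j (axis c 1))"

definition euclid_flow :: "real ^ 'n ^ 'n \<Rightarrow> (real ^ 'n ^ 'n \<Rightarrow> real) \<Rightarrow> real set
    \<Rightarrow> (real \<Rightarrow> real ^ 'n ^ 'n) \<Rightarrow> bool" where
  "euclid_flow C F I U \<longleftrightarrow> (\<forall>t\<in>I. (U has_vector_derivative
     (\<chi> i a. - (1/4) * (\<Sum>c\<in>UNIV. \<Sum>j\<in>UNIV.
        matrix_inv C $ a $ c * C $ i $ j * D_comp F (U t) c j))) (at t within I))"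

definition riem_field :: "real ^ 'n ^ 'n \<Rightarrow> real ^ 'n ^ 'n \<Rightarrow> real ^ 'n ^ 'n \<Rightarrow> real ^ 'n ^ 'n" where
  "riem_field C S A = (\<chi> a b. - (1/2) * (\<Sum>c\<in>UNIV. \<Sum>d\<in>UNIV.
     S $ a $ c * matrix_inv C $ b $ d * A $ c $ d + S $ b $ d * matrix_inv C $ a $ c * A $ c $ d))"

definition riem_flow :: "real ^ 'n ^ 'n \<Rightarrow> (real ^ 'n ^ 'n \<Rightarrow> real ^ 'n ^ 'n) \<Rightarrow> real set
    \<Rightarrow> (real \<Rightarrow> real ^ 'n ^ 'n) \<Rightarrow> bool" where
  "riem_flow C DF I S \<longleftrightarrow> (\<forall>t\<in>I. S t \<in> Sym_ge0 \<and>
     (S has_vector_derivative riem_field C (S t) (DF (S t))) (at t within I))"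

text \<open>
  The metric on cotangent vectors, and the fact that \<open>riem_field C S A\<close> is minus the tangent
  vector dual to \<open>A\<close>, so that \<open>riem_flow\<close> is the downward Riemannian gradient flow.
\<close>

definition cometric ::
  "real ^ 'n ^ 'n \<Rightarrow> real ^ 'n ^ 'n \<Rightarrow> real ^ 'n ^ 'n \<Rightarrow> real ^ 'n ^ 'n \<Rightarrow> real" where
  "cometric C S A A' = (\<Sum>a\<in>UNIV. \<Sum>b\<in>UNIV. \<Sum>c\<in>UNIV. \<Sum>d\<in>UNIV.
     1/2 * (S $ a $ b * matrix_inv C $ c $ d * A $ a $ c * A' $ b $ d)
     + 1/2 * (S $ a $ b * matrix_inv C $ c $ d * A $ b $ d * A' $ a $ c))"

lemma riem_field_gradient:
  fixes C S A A' :: "real ^ 'n ^ 'n"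
  assumes "transpose S = S" "transpose (matrix_inv C) = matrix_inv C"
    and "transpose A = A" "transpose A' = A'"
  shows "pairing A' (riem_field C S A) = - cometric C S A A'"
proof -
  define G where "G = matrix_inv C"
  have sy: "S $ i $ j = S $ j $ i" "G $ i $ j = G $ j $ i"
    "A $ i $ j = A $ j $ i" "A' $ i $ j = A' $ j $ i" for i j
    using assms[THEN arg_cong[where f = "\<lambda>B. B $ i $ j"]] by (simp_all add: transpose_def G_def)
  let ?s = "\<lambda>f. \<Sum>a\<in>UNIV. \<Sum>b\<in>UNIV. \<Sum>c\<in>UNIV. \<Sum>d\<in>(UNIV::'n set). (f a b c d :: real)"
  have sw: "?s f = ?s (\<lambda>a b c d. f a c b d)" for f
    by (rule sum.cong[OF refl], rule sum.swap)
  have sw2: "?s f = ?s (\<lambda>a b c d. f b a d c)" for f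
    by (rule trans[OF sum.swap], rule sum.cong[OF refl], rule sum.cong[OF refl], rule sum.swap)
  define T where "T = ?s (\<lambda>a b c d. S $ a $ b * G $ c $ d * A $ b $ d * A' $ a $ c)"
  have T1: "?s (\<lambda>a b c d. S $ a $ b * G $ c $ d * A $ a $ c * A' $ b $ d) = T"
    unfolding T_def by (subst sw2) (intro sum.cong refl, simp add: sy mult_ac)
  have T2: "?s (\<lambda>a b c d. A' $ a $ b * (S $ a $ c * G $ b $ d * A $ c $ d)) = T"
    unfolding T_def by (subst sw) (intro sum.cong refl, simp add: mult_ac)
  have T3: "?s (\<lambda>a b c d. A' $ a $ b * (S $ b $ d * G $ a $ c * A $ c $ d)) = T"
    by (subst sw2, subst T2[symmetric]) (intro sum.cong refl, simp add: sy mult_ac)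
  have "cometric C S A A' = 1/2 * T + 1/2 * T"
    unfolding cometric_def G_def[symmetric] sum.distrib sum_distrib_left[symmetric] T1
    by (simp add: T_def)
  moreover have "pairing A' (riem_field C S A) = - (1/2) * (T + T)"
  proof -
    have "pairing A' (riem_field C S A) = ?s (\<lambda>a b c d.
        - (1/2) * (A' $ a $ b * (S $ a $ c * G $ b $ d * A $ c $ d)
                 + A' $ a $ b * (S $ b $ d * G $ a $ c * A $ c $ d)))"
      unfolding pairing_def riem_field_def G_def[symmetric]
      by (simp add: sum_distrib_left sum_negf[symmetric] algebra_simps)
    then show ?thesis
      using T2 T3 unfolding sum_distrib_left[symmetric] sum.distrib by simp
  qed
  ultimately show ?thesis by simp
qed

end

theory Submission
  imports Defs
begin

text \<open>
  If \<open>proj C U = proj C U'\<close>, then \<open>U = A U'\<close> for some \<open>A\<close> that is orthogonal for the inverse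
  covariance. Composition with \<open>A\<close> transforms the spectral side by the dual rotation, which preserves
  both \<open>k\<close> and Lebesgue measure; hence it permutes the Hilbert space isometrically and
  \<open>J = \<J> \<circ> proj C\<close>. The chain rule then gives \<open>DJ = 2 G U D\<J>\<close> with \<open>G = C\<^sup>-\<^sup>1\<close>, so the Euclidean
  flow is \<open>dU/dt = - 1/2 U D\<J> G\<close>, and the product rule turns this into the Riemannian flow of
  \<open>\<Sigma> = U\<^sup>T G U\<close>.
\<close>

section \<open>Linear maps that preserve Lebesgue measure\<close>

lemma nn_integral_lborel_translate:
  fixes f :: "'a::euclidean_space \<Rightarrow> ennreal"
  assumes [measurable]: "f \<in> borel_measurable borel"
  shows "(\<integral>\<^sup>+x. f (x + c) \<partial>lborel) = (\<integral>\<^sup>+x. f x \<partial>lborel)"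
proof -
  have "(\<integral>\<^sup>+x. f x \<partial>lborel) = (\<integral>\<^sup>+x. f x \<partial>distr lborel borel ((+) c))"
    by (simp add: lborel_distr_plus)
  also have "\<dots> = (\<integral>\<^sup>+x. f (c + x) \<partial>lborel)"
    by (subst nn_integral_distr) simp_all
  finally show ?thesis
    by (simp add: add.commute)
qed

lemma nn_integral_lborel_reflect:
  fixes f :: "'a::euclidean_space \<Rightarrow> ennreal"
  assumes [measurable]: "f \<in> borel_measurable borel"
  shows "(\<integral>\<^sup>+x. f (c - x) \<partial>lborel) = (\<integral>\<^sup>+x. f x \<partial>lborel)"
proof -
  have "(\<integral>\<^sup>+x. f x \<partial>lborel) = (\<integral>\<^sup>+x. f x \<partial>distr lborel borel (\<lambda>x. c + (- 1) *\<^sub>R x))"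
    by (subst lborel_affine[of "- 1" c]) (simp_all add: nn_integral_density)
  also have "\<dots> = (\<integral>\<^sup>+x. f (c - x) \<partial>lborel)"
    by (subst nn_integral_distr) simp_all
  finally show ?thesis by simp
qed

text \<open>
  The Fubini argument for uniqueness of Haar measure: \<open>T\<close> scales Lebesgue measure by a constant,
  which is 1 because the invariant set \<open>E\<close> has positive finite measure.
\<close>

lemma distr_lborel_linear:
  fixes T S :: "'a::euclidean_space \<Rightarrow> 'a"
  assumes T: "linear T" and TS: "\<And>y. T (S y) = y"
    and E: "compact E" "interior E \<noteq> {}" "T -` E = E"
  shows "distr lborel borel T = lborel"
proof (rule measure_eqI)
  fix A assume "A \<in> sets (distr lborel borel T)"
  then have A[measurable]: "A \<in> sets borel" by simp
  have E'[measurable]: "E \<in> sets borel"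
    using E(1) by (simp add: borel_compact)
  have Tm[measurable]: "T \<in> borel_measurable borel"
    using T by (simp add: borel_measurable_continuous_onI linear_continuous_on linear_conv_bounded_linear)
  have TmA: "T -` A \<in> sets borel"
    using measurable_sets[OF Tm A] by simp
  have "emeasure lborel (T -` A) * emeasure lborel E
      = (\<integral>\<^sup>+x. (\<integral>\<^sup>+y. indicator A (T x) * indicator E y \<partial>lborel) \<partial>lborel)"
    using TmA by (simp add: nn_integral_cmult nn_integral_multc indicator_vimage[symmetric])
  \<comment> \<open>Shifting \<open>y\<close> by \<open>T x\<close> couples the two variables. After
    the integrals are swapped, shifting \<open>x\<close> by \<open>S (- y)\<close> replaces
    \<open>T x\<close> by \<open>T x - y\<close>, which moves the shift from the factor of
    \<open>E\<close> to that of \<open>A\<close>.\<close>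
  also have "\<dots> = (\<integral>\<^sup>+x. (\<integral>\<^sup>+y. indicator A (T x) * indicator E (y + T x) \<partial>lborel) \<partial>lborel)"
    by (intro nn_integral_cong sym[OF nn_integral_lborel_translate]) measurable
  also have "\<dots> = (\<integral>\<^sup>+y. (\<integral>\<^sup>+x. indicator A (T x) * indicator E (y + T x) \<partial>lborel) \<partial>lborel)"
    by (rule lborel_pair.Fubini') measurable
  also have "\<dots> = (\<integral>\<^sup>+y. (\<integral>\<^sup>+x. indicator A (T (x + S (- y))) * indicator E (y + T (x + S (- y))) \<partial>lborel) \<partial>lborel)"
    by (intro nn_integral_cong sym[OF nn_integral_lborel_translate]) measurable
  also have "\<dots> = (\<integral>\<^sup>+y. (\<integral>\<^sup>+x. indicator A (T x - y) * indicator E (T x) \<partial>lborel) \<partial>lborel)"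
    using linear_add[OF T] TS by simp
  also have "\<dots> = (\<integral>\<^sup>+x. (\<integral>\<^sup>+y. indicator A (T x - y) * indicator E (T x) \<partial>lborel) \<partial>lborel)"
    by (rule lborel_pair.Fubini') measurable
  also have "\<dots> = (\<integral>\<^sup>+x. (\<integral>\<^sup>+y. indicator A y * indicator E (T x) \<partial>lborel) \<partial>lborel)"
    by (intro nn_integral_cong nn_integral_lborel_reflect) measurable
  also have "\<dots> = emeasure lborel A * emeasure lborel E"
    using E(3) by (simp add: nn_integral_cmult nn_integral_multc indicator_vimage[symmetric])
  finally have eq: "emeasure lborel (T -` A) * emeasure lborel E = emeasure lborel A * emeasure lborel E" .
  \<comment> \<open>Cancelling the measure of \<open>E\<close> requires it to be finite, by
    compactness, and nonzero, by the nonempty interior.\<close>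
  have "emeasure lborel E \<noteq> \<infinity>"
    using emeasure_compact_finite[OF E(1)] by simp
  moreover have "emeasure lborel E \<noteq> 0"
  proof
    assume "emeasure lborel E = 0"
    then have "emeasure lborel (interior E) = 0"
      using emeasure_mono[OF interior_subset, of E lborel] by simp
    then show False
      using open_not_negligible[OF open_interior E(2)] null_sets_completionI[of "interior E" lborel] by (auto simp: negligible_iff_null_sets null_sets_def)
  qed
  ultimately have "emeasure lborel (T -` A) = emeasure lborel A"
    using eq by (simp add: ennreal_mult_cancel_left mult.commute[of _ "emeasure lborel E"])
  then show "emeasure (distr lborel borel T) A = emeasure lborel A"
    by (simp add: emeasure_distr)
qed simp

section \<open>Gram factorization and extension of partial isometries\<close>

text \<open>Lagrange's reduction of a quadratic form to a sum of squares, one coordinate at a time.\<close>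

lemma psd_gram_factor_aux:
  fixes b :: "real^'n \<Rightarrow> real^'n \<Rightarrow> real"
  assumes "finite I" "bilinear b" "\<And>x y. b x y = b y x" "\<And>x. 0 \<le> b x x"
    "\<And>i y. i \<notin> I \<Longrightarrow> b (axis i 1) y = 0"
  shows "\<exists>r. (\<forall>i. linear (r i)) \<and> (\<forall>x. b x x = (\<Sum>i\<in>I. (r i x)\<^sup>2))"
  using assms
proof (induction I arbitrary: b rule: finite_induct)
  case empty
  have "b x y = 0" for x y
  proof -
    have "b x y = b (\<Sum>i\<in>UNIV. (x $ i) *\<^sub>R axis i 1) y"
      by (simp add: basis_expansion scalar_mult_eq_scaleR[symmetric])
    also have "\<dots> = (\<Sum>i\<in>UNIV. (x $ i) *\<^sub>R b (axis i 1) y)"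
      using empty(1) by (simp add: bilinear_def linear_sum[of "\<lambda>x. b x y"] linear_cmul[of "\<lambda>x. b x y"])
    finally show ?thesis using empty(4) by simp
  qed
  then show ?case by (auto intro: exI[of _ "\<lambda>_ _. 0"] simp: linear_zero)
next
  case (insert i I)
  note bil = \<open>bilinear b\<close> and sym = insert.prems(2) and psd = insert.prems(3) and supp = insert.prems(4)
  define e where "e = (axis i 1 :: real^'n)"
  note bs = bilinear_ladd[OF bil] bilinear_radd[OF bil] bilinear_lmul[OF bil] bilinear_rmul[OF bil]
  have quad: "b (x + t *\<^sub>R e) (x + t *\<^sub>R e) = b x x + 2 * t * b e x + t\<^sup>2 * b e e" for x t
    by (simp add: bs sym[of x e] power2_eq_square algebra_simps)
  have lin: "linear (b e)" using bil by (simp add: bilinear_def)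
  show ?case
  proof (cases "b e e = 0")
    case True
    \<comment> \<open>When \<open>b e e = 0\<close>, \<open>quad\<close> is affine in
      \<open>t\<close>. A nonzero slope would allow the value -1, attained at the \<open>t\<close>
      chosen here, against positivity. So \<open>e\<close> lies in the radical of
      \<open>b\<close>.\<close>
    have be: "b e x = 0" for x
    proof (rule ccontr)
      assume ne: "b e x \<noteq> 0"
      have "0 \<le> b x x + 2 * (- (b x x + 1) / (2 * b e x)) * b e x"
        using psd[of "x + (- (b x x + 1) / (2 * b e x)) *\<^sub>R e"] True unfolding quad by simp
      also have "\<dots> = - 1" using ne by (simp add: field_simps)
      finally show False by simp
    qed
    have "\<And>j y. j \<notin> I \<Longrightarrow> b (axis j 1) y = 0"
      using supp be unfolding e_def by (metis insert_iff)
    from insert.IH[OF bil sym psd this] obtain r where r: "\<And>j. linear (r j)" "\<And>x. b x x = (\<Sum>j\<in>I. (r j x)\<^sup>2)"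
      by blast
    show ?thesis
    proof (intro exI[of _ "r(i := \<lambda>_. 0)"] conjI allI)
      show "linear ((r(i := \<lambda>_. 0)) j)" for j using r(1) by (auto simp: linear_zero)
      have "(\<Sum>j\<in>I. ((r(i := \<lambda>_. 0)) j x)\<^sup>2) = (\<Sum>j\<in>I. (r j x)\<^sup>2)" for x
        using insert.hyps(2) by (intro sum.cong) auto
      then show "b x x = (\<Sum>j\<in>insert i I. ((r(i := \<lambda>_. 0)) j x)\<^sup>2)" for x
        using r(2) insert.hyps by simp
    qed
  next
    case False
    then have pos: "b e e > 0" using psd[of e] by simp
    \<comment> \<open>Completing the square: \<open>b'\<close> has \<open>e\<close> in its radical,
      so its support shrinks to \<open>I\<close>. It stays nonnegative because \<open>b' x x\<close>
      is the minimum over \<open>t\<close> of \<open>b (x + t e) (x + t e)\<close>, attained at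
      \<open>t = - b e x / b e e\<close>.\<close>
    define b' where "b' = (\<lambda>x y. b x y - b e x * b e y / b e e)"
    have "bilinear b'"
      unfolding bilinear_def b'_def
      by (auto intro!: linearI simp: bs algebra_simps add_divide_distrib diff_divide_distrib)
    moreover have "b' x y = b' y x" for x y
      unfolding b'_def using sym by simp
    moreover have "0 \<le> b' x x" for x
      using psd[of "x + (- b e x / b e e) *\<^sub>R e"] pos unfolding quad b'_def
      by (simp add: field_simps power2_eq_square)
    moreover have "b' (axis j 1) y = 0" if "j \<notin> I" for j y
    proof (cases "j = i")
      case True
      then show ?thesis using pos by (simp add: b'_def e_def)
    next
      case ji: False
      then have "b (axis j 1) y = 0" "b e (axis j 1) = 0"
        using supp[of j] that sym by auto
      then show ?thesis by (simp add: b'_def)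
    qed
    ultimately obtain r where r: "\<And>j. linear (r j)" "\<And>x. b' x x = (\<Sum>j\<in>I. (r j x)\<^sup>2)"
      using insert.IH[of b'] by blast
    \<comment> \<open>Since \<open>i\<close> is not in \<open>I\<close>, the slot \<open>i\<close>
      is free to hold the linear form whose square was split off.\<close>
    define r' where "r' = r(i := \<lambda>x. b e x / sqrt (b e e))"
    show ?thesis
    proof (intro exI[of _ r'] conjI allI)
      show "linear (r' j)" for j
        using r(1) lin by (auto simp: r'_def linear_iff add_divide_distrib)
      have "(\<Sum>j\<in>I. (r' j x)\<^sup>2) = (\<Sum>j\<in>I. (r j x)\<^sup>2)" for x
        unfolding r'_def using insert.hyps(2) by (intro sum.cong) auto
      then show "b x x = (\<Sum>j\<in>insert i I. (r' j x)\<^sup>2)" for x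
        using r(2)[of x, symmetric] insert.hyps pos
        by (simp add: r'_def b'_def power_divide power2_eq_square[of "b e x"])
    qed
  qed
qed

text \<open>Polarization: the values at \<open>x\<close>, \<open>y\<close> and \<open>x + y\<close>
  determine the symmetric bilinear form.\<close>

lemma symmetric_matrix_eqI:
  fixes S T :: "real^'n^'n"
  assumes "transpose S = S" "transpose T = T" "\<And>x. x \<bullet> (S *v x) = x \<bullet> (T *v x)"
  shows "S = T"
proof -
  have sym: "x \<bullet> (S *v y) = y \<bullet> (S *v x)" "x \<bullet> (T *v y) = y \<bullet> (T *v x)" for x y
    using assms(1,2) by (metis dot_lmul_matrix inner_commute vector_transpose_matrix)+
  have "x \<bullet> (S *v y) = x \<bullet> (T *v y)" for x y
    using assms(3)[of "x + y"] assms(3)[of x] assms(3)[of y] sym[of x y]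
    by (simp add: inner_add_left inner_add_right matrix_vector_right_distrib)
  then have "S *v y = T *v y" for y
    by (metis inner_commute vector_eq_rdot)
  then show ?thesis by (simp add: matrix_eq)
qed

lemma norm_matrix_vector_sq:
  fixes R :: "real^'n^'n"
  shows "(norm (R *v x))\<^sup>2 = x \<bullet> ((transpose R ** R) *v x)"
  by (simp add: matrix_vector_mul_assoc[symmetric] inner_commute[of x] dot_lmul_matrix power2_norm_eq_inner)

text \<open>The linear forms from the sum of squares become the rows of \<open>R\<close>;
  polarization then lifts equality of quadratic forms to equality of matrices. For positive definite
  \<open>G\<close>, this \<open>R\<close> serves as a square root in changes of coordinates.\<close>

lemma psd_gram_factor:
  fixes G :: "real^'n^'n"
  assumes "transpose G = G" "\<And>x. 0 \<le> x \<bullet> (G *v x)"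
  obtains R :: "real^'n^'n" where "G = transpose R ** R"
proof -
  have sym: "x \<bullet> (G *v y) = y \<bullet> (G *v x)" for x y
    using assms(1) by (metis dot_lmul_matrix inner_commute vector_transpose_matrix)
  have bil: "bilinear (\<lambda>x y. x \<bullet> (G *v y))"
    unfolding bilinear_def
    by (auto intro!: linearI simp: inner_add_left inner_add_right matrix_vector_right_distrib
        matrix_vector_mult_scaleR)
  from psd_gram_factor_aux[OF finite_class.finite_UNIV bil sym assms(2)]
  obtain r :: "'n \<Rightarrow> real^'n \<Rightarrow> real" where r: "\<And>i. linear (r i)" "\<And>x. x \<bullet> (G *v x) = (\<Sum>i\<in>UNIV. (r i x)\<^sup>2)"
    by auto
  define R where "R = matrix (\<lambda>x. \<chi> i. r i x)"
  have "linear (\<lambda>x. \<chi> i. r i x)"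
    using r(1) by (auto simp: linear_iff vec_eq_iff)
  then have R: "R *v x = (\<chi> i. r i x)" for x
    unfolding R_def by (simp add: matrix_works)
  have "(norm (R *v x))\<^sup>2 = (\<Sum>i\<in>UNIV. (r i x)\<^sup>2)" for x
    unfolding power2_norm_eq_inner by (simp add: R inner_vec_def power2_eq_square)
  then have "x \<bullet> (G *v x) = x \<bullet> ((transpose R ** R) *v x)" for x
    by (simp only: norm_matrix_vector_sq r(2))
  moreover have "transpose (transpose R ** R) = transpose R ** R"
    by (simp add: matrix_transpose_mul)
  ultimately have "G = transpose R ** R"
    using symmetric_matrix_eqI[OF assms(1)] by blast
  then show ?thesis by (rule that)
qed

text \<open>Equal norms make \<open>B *v x \<mapsto> A *v x\<close> a well defined isometry between
  the two ranges. Their orthogonal complements then have equal dimension, and any linear isometry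
  between these completes the map to an orthogonal one. Working on ranges covers singular
  \<open>A\<close> and \<open>B\<close>.\<close>

lemma orthogonal_extension_matrix:
  fixes A B :: "real^'n^'n"
  assumes eq: "\<And>x. norm (A *v x) = norm (B *v x)"
  obtains Q where "orthogonal_matrix Q" "A = Q ** B"
proof -
  define V where "V = range ((*v) B)"
  define W where "W = range ((*v) A)"
  have sub: "subspace V" "subspace W"
    unfolding V_def W_def by (simp_all add: linear_subspace_image)
  define V' where "V' = {y. \<forall>x\<in>V. orthogonal x y}"
  define W' where "W' = {y. \<forall>x\<in>W. orthogonal x y}"
  have sub': "subspace V'" "subspace W'"
    unfolding V'_def W'_def by (simp_all add: subspace_orthogonal_to_vectors)
  have "linear ((*v) B)" by simp
  from linear_exists_right_inverse_on[OF this subspace_UNIV]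
  obtain h where h: "linear h" "\<And>v. v \<in> V \<Longrightarrow> B *v h v = v"
    unfolding V_def by blast
  define L where "L = (\<lambda>v. A *v h v)"
  have linL: "linear L"
    unfolding L_def using h(1) by (auto simp: linear_iff matrix_vector_right_distrib matrix_vector_mult_scaleR)
  \<comment> \<open>\<open>h (B *v x) - x\<close> lies in the kernel of \<open>B\<close>, which by
    \<open>eq\<close> is also the kernel of \<open>A\<close>.\<close>
  have LB: "L (B *v x) = A *v x" for x
  proof -
    have "norm (A *v (h (B *v x) - x)) = 0"
      unfolding eq by (simp add: matrix_vector_mult_diff_distrib h(2) V_def)
    then show ?thesis unfolding L_def by (simp add: matrix_vector_mult_diff_distrib)
  qed
  have normL: "norm (L v) = norm v" if "v \<in> V" for v
    using that LB eq unfolding V_def by auto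
  have LV: "L ` V = W"
    unfolding V_def W_def by (auto simp: LB image_iff)
  have "inj_on L V"
  proof (rule inj_onI)
    fix x y assume "x \<in> V" "y \<in> V" "L x = L y"
    then have "norm (x - y) = 0"
      using normL[of "x - y"] linL sub by (simp add: linear_diff subspace_diff)
    then show "x = y" by simp
  qed
  then have "dim V = dim W"
    using dim_image_eq[OF linL, of V] sub LV by (metis span_eq_iff)
  then have "dim V' = dim W'"
    using dim_subspace_orthogonal_to_vectors[OF sub(1) subspace_UNIV]
      dim_subspace_orthogonal_to_vectors[OF sub(2) subspace_UNIV]
    unfolding V'_def W'_def by simp
  from isometries_subspaces[OF sub' this] obtain g
    where g: "linear g" "g ` V' = W'" "\<And>x. x \<in> V' \<Longrightarrow> norm (g x) = norm x"
    by metis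
  have "\<exists>y. y \<in> V \<and> x - y \<in> V'" for x
  proof -
    obtain y z where "y \<in> span V" "\<And>w. w \<in> span V \<Longrightarrow> orthogonal z w" "x = y + z"
      using orthogonal_subspace_decomp_exists[of V x] by metis
    then show ?thesis
      using span_eq_iff[THEN iffD2, OF sub(1)] unfolding V'_def
      by (auto simp: orthogonal_commute intro!: exI[of _ y])
  qed
  then obtain p where p: "\<And>x. p x \<in> V" "\<And>x. x - p x \<in> V'"
    by metis
  \<comment> \<open>\<open>p\<close> is the orthogonal projection onto \<open>V\<close>. Uniqueness
    of the decomposition, from \<open>V\<close> and \<open>V'\<close> meeting only in 0, is what
    makes the pointwise choice of \<open>p\<close> linear.\<close>
  have p_unique: "p x = y" if "y \<in> V" "x - y \<in> V'" for x y
  proof -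
    have "p x - y \<in> V" using p that sub subspace_diff by blast
    moreover have "p x - y = (x - y) - (x - p x)" by simp
    then have "p x - y \<in> V'" using p(2)[of x] that sub' subspace_diff by metis
    ultimately have "orthogonal (p x - y) (p x - y)" unfolding V'_def by blast
    then show ?thesis by (simp add: orthogonal_self)
  qed
  have linp: "linear p"
  proof (rule linearI)
    fix x y :: "real^'n" and c :: real
    have "(x + y) - (p x + p y) = (x - p x) + (y - p y)" by simp
    then show "p (x + y) = p x + p y"
      by (intro p_unique) (metis p(1) sub(1) subspace_add, metis p(2) sub'(1) subspace_add)
    have "c *\<^sub>R x - c *\<^sub>R p x = c *\<^sub>R (x - p x)" by (simp add: scaleR_diff_right)
    then show "p (c *\<^sub>R x) = c *\<^sub>R p x"
      by (intro p_unique) (metis p(1) sub(1) subspace_scale, metis p(2) sub'(1) subspace_scale)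
  qed
  define q where "q = (\<lambda>x. L (p x) + g (x - p x))"
  have linq: "linear q"
    unfolding q_def using linL linp g(1)
    by (intro linear_compose_add linear_compose[of p L, unfolded o_def]
        linear_compose[of "\<lambda>x. x - p x" g, unfolded o_def] linear_compose_sub linear_ident)
  \<comment> \<open>Pythagoras is applied twice: to the images in \<open>W\<close> and
    \<open>W'\<close>, and to the components of \<open>x\<close> in \<open>V\<close> and
    \<open>V'\<close>.\<close>
  have "norm (q x) = norm x" for x
  proof -
    have "orthogonal (L (p x)) (g (x - p x))"
      using LV g(2) p unfolding W'_def by blast
    then have "(norm (q x))\<^sup>2 = (norm (p x))\<^sup>2 + (norm (x - p x))\<^sup>2"
      unfolding q_def by (simp add: norm_add_Pythagorean normL g(3) p)
    also have "\<dots> = (norm (p x + (x - p x)))\<^sup>2"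
      using p[of x] unfolding V'_def by (intro norm_add_Pythagorean[symmetric]) blast
    finally show ?thesis by simp
  qed
  then have "orthogonal_transformation q"
    using linq by (simp add: orthogonal_transformation)
  then have "orthogonal_matrix (matrix q)"
    by (simp add: orthogonal_transformation_matrix)
  moreover have "A = matrix q ** B"
  proof -
    have "p (B *v x) = B *v x" for x
      using sub'(1) by (intro p_unique) (auto simp: V_def subspace_0)
    then have "q (B *v x) = A *v x" for x
      by (simp add: q_def LB linear_0[OF g(1)])
    moreover have "matrix q *v y = q y" for y
      using linq by (simp add: matrix_works)
    ultimately have "A *v x = (matrix q ** B) *v x" for x
      by (simp add: matrix_vector_mul_assoc[symmetric])
    then show ?thesis by (simp add: matrix_eq)
  qed
  ultimately show ?thesis by (rule that)
qed

section \<open>Invariance of the functional under rotations\<close>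

text \<open>Moving \<open>A\<close> to the other side of the pairing turns the phase of
  \<open>f (A *v x)\<close> into that of \<open>transpose A *v \<omega>\<close> against
  \<open>x\<close>. Substituting this as the new frequency replaces \<open>g\<close> by its
  composition with \<open>transpose B\<close>, the inverse of \<open>transpose A\<close>. No
  Jacobian appears by \<open>distr\<close>, and the weight is unchanged by
  \<open>kA\<close>.\<close>

lemma is_transform_rotate:
  fixes A B :: "real^'n^'n" and k :: "real^'n \<Rightarrow> real"
  assumes AB: "A ** B = mat 1"
    and distr: "distr lborel borel ((*v) (transpose A)) = lborel"
    and km[measurable]: "k \<in> borel_measurable borel"
    and kA: "\<And>\<omega>. k (transpose A *v \<omega>) = k \<omega>"
    and tr: "is_transform k f g"
  shows "is_transform k (\<lambda>x. f (A *v x)) (\<lambda>\<omega>. g (transpose B *v \<omega>))"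
    and "(LINT \<omega>|lborel. (cmod (g (transpose B *v \<omega>)))\<^sup>2 / k \<omega>) = (LINT \<omega>|lborel. (cmod (g \<omega>))\<^sup>2 / k \<omega>)"
proof -
  have gm[measurable]: "g \<in> borel_measurable borel"
    and int: "integrable lborel (\<lambda>\<omega>. (cmod (g \<omega>))\<^sup>2 / k \<omega>)" and f: "f = fourier_synth g"
    using tr by (simp_all add: is_transform_def)
  have mv[measurable]: "(*v) N \<in> borel_measurable borel" for N :: "real^'n^'n"
    by (intro borel_measurable_continuous_onI linear_continuous_on) (simp add: linear_linear)
  have inv: "transpose B *v (transpose A *v \<omega>) = \<omega>" for \<omega>
    by (simp only: matrix_vector_mul_assoc matrix_transpose_mul[symmetric] AB transpose_mat matrix_vector_mul_lid)
  have adj: "(transpose A *v \<omega>) \<bullet> x = \<omega> \<bullet> (A *v x)" for \<omega> x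
    by (simp add: dot_lmul_matrix)
  \<comment> \<open>This rule rewrites \<open>transpose A *v \<omega>\<close> to
    \<open>\<omega> v* A\<close>, which \<open>inv\<close>, \<open>adj\<close> and \<open>kA\<close>
    would no longer match.\<close>
  note [simp del] = transpose_matrix_vector
  define h where "h = (\<lambda>\<omega>. g (transpose B *v \<omega>))"
  have hm[measurable]: "h \<in> borel_measurable borel"
    unfolding h_def by measurable
  have subst_int: "(LINT \<omega>|lborel. F \<omega>) = (LINT \<omega>|lborel. F (transpose A *v \<omega>))"
    if "F \<in> borel_measurable borel" for F :: "real^'n \<Rightarrow> 'b::{banach, second_countable_topology}"
    using integral_distr[of "(*v) (transpose A)" lborel borel F] that by (simp add: distr)
  have "integrable (distr lborel borel ((*v) (transpose A))) (\<lambda>\<omega>. (cmod (h \<omega>))\<^sup>2 / k \<omega>)"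
    by (subst integrable_distr_eq) (use int in \<open>simp_all add: h_def inv kA\<close>)
  then have "integrable lborel (\<lambda>\<omega>. (cmod (h \<omega>))\<^sup>2 / k \<omega>)"
    by (simp add: distr)
  moreover have "f (A *v x) = fourier_synth h x" for x
  proof -
    have [measurable]: "(\<lambda>\<omega>. cis (2 * pi * (\<omega> \<bullet> x))) \<in> borel_measurable borel"
      by (intro borel_measurable_continuous_onI continuous_intros)
    have "fourier_synth h x = (LINT \<omega>|lborel. h (transpose A *v \<omega>) * cis (2 * pi * ((transpose A *v \<omega>) \<bullet> x)))"
      unfolding fourier_synth_def by (rule subst_int) measurable
    also have "\<dots> = f (A *v x)"
      by (simp add: f fourier_synth_def h_def inv adj)
    finally show ?thesis by simp
  qed
  ultimately show "is_transform k (\<lambda>x. f (A *v x)) (\<lambda>\<omega>. g (transpose B *v \<omega>))"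
    unfolding is_transform_def h_def[symmetric] by auto
  show "(LINT \<omega>|lborel. (cmod (g (transpose B *v \<omega>)))\<^sup>2 / k \<omega>) = (LINT \<omega>|lborel. (cmod (g \<omega>))\<^sup>2 / k \<omega>)"
    by (subst subst_int) (simp_all add: inv kA)
qed

text \<open>Composition with \<open>A\<close> is a norm-preserving bijection of
  \<open>hilb k\<close>, and composing \<open>f\<close> with \<open>A\<close> before evaluating at
  \<open>U *v X w\<close> is the same as evaluating \<open>f\<close> at
  \<open>(A ** U) *v X w\<close>. The infimum is merely reindexed.\<close>

lemma J_fun_rotate:
  fixes A B U :: "real^'n^'n" and k :: "real^'n \<Rightarrow> real"
  assumes AB: "A ** B = mat 1"
    and distr: "distr lborel borel ((*v) (transpose A)) = lborel"
    and km: "k \<in> borel_measurable borel"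
    and kA: "\<And>\<omega>. k (transpose A *v \<omega>) = k \<omega>"
  shows "J_fun M X Y k lam (A ** U) = J_fun M X Y k lam U"
proof -
  have BA: "B ** A = mat 1" using AB by (simp add: matrix_left_right_inverse)
  have mv: "(*v) N \<in> borel_measurable borel" for N :: "real^'n^'n"
    by (intro borel_measurable_continuous_onI linear_continuous_on) (simp add: linear_linear)
  have inv: "transpose B *v (transpose A *v \<omega>) = \<omega>" "transpose A *v (transpose B *v \<omega>) = \<omega>" for \<omega>
    by (simp_all only: matrix_vector_mul_assoc matrix_transpose_mul[symmetric] AB BA transpose_mat matrix_vector_mul_lid)
  have inv': "A *v (B *v x) = x" "B *v (A *v x) = x" for x
    by (simp_all add: matrix_vector_mul_assoc AB BA)
  note [simp del] = transpose_matrix_vector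
  \<comment> \<open>The inverse rotation satisfies the same two invariances, so the transform lemma
    applies in both directions.\<close>
  have kB: "k (transpose B *v \<omega>) = k \<omega>" for \<omega>
    using kA[of "transpose B *v \<omega>"] by (simp add: inv)
  have "distr lborel borel ((*v) (transpose B)) = distr (distr lborel borel ((*v) (transpose A))) borel ((*v) (transpose B))"
    by (simp add: distr)
  also have "\<dots> = distr lborel borel (\<lambda>\<omega>. \<omega>)"
    by (subst distr_distr) (simp_all add: mv o_def inv)
  also have "\<dots> = lborel" by (rule distr_id2) simp
  finally have distrB: "distr lborel borel ((*v) (transpose B)) = lborel" .
  note rA = is_transform_rotate[OF AB distr km kA] and rB = is_transform_rotate[OF BA distrB km kB]
  \<comment> \<open>Stated for all \<open>P\<close>, so that it yields equality of the two \<open>THE\<close> terms without uniqueness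
    of the transform.\<close>
  have trans_iff: "(\<exists>g. is_transform k (\<lambda>x. f (A *v x)) g \<and> P (LINT \<omega>|lborel. (cmod (g \<omega>))\<^sup>2 / k \<omega>))
      \<longleftrightarrow> (\<exists>g. is_transform k f g \<and> P (LINT \<omega>|lborel. (cmod (g \<omega>))\<^sup>2 / k \<omega>))" for f P
  proof
    assume "\<exists>g. is_transform k (\<lambda>x. f (A *v x)) g \<and> P (LINT \<omega>|lborel. (cmod (g \<omega>))\<^sup>2 / k \<omega>)"
    then obtain g where "is_transform k (\<lambda>x. f (A *v x)) g" "P (LINT \<omega>|lborel. (cmod (g \<omega>))\<^sup>2 / k \<omega>)"
      by blast
    with rB[OF this(1)] show "\<exists>g. is_transform k f g \<and> P (LINT \<omega>|lborel. (cmod (g \<omega>))\<^sup>2 / k \<omega>)"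
      by (auto simp: inv' intro!: exI[of _ "\<lambda>\<omega>. g (transpose A *v \<omega>)"])
  next
    assume "\<exists>g. is_transform k f g \<and> P (LINT \<omega>|lborel. (cmod (g \<omega>))\<^sup>2 / k \<omega>)"
    then obtain g where "is_transform k f g" "P (LINT \<omega>|lborel. (cmod (g \<omega>))\<^sup>2 / k \<omega>)"
      by blast
    with rA[OF this(1)] show "\<exists>g. is_transform k (\<lambda>x. f (A *v x)) g \<and> P (LINT \<omega>|lborel. (cmod (g \<omega>))\<^sup>2 / k \<omega>)"
      by (auto intro!: exI[of _ "\<lambda>\<omega>. g (transpose B *v \<omega>)"])
  qed
  have norm_eq: "hilb_norm_sq k (\<lambda>x. f (A *v x)) = hilb_norm_sq k f" for f
    unfolding hilb_norm_sq_def trans_iff ..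
  have hilb_iff: "(\<lambda>x. f (A *v x)) \<in> hilb k \<longleftrightarrow> f \<in> hilb k" for f
    using trans_iff[of f "\<lambda>_. True"] by (simp add: hilb_def)
  have hilb_eq: "hilb k = (\<lambda>f x. f (A *v x)) ` hilb k"
  proof (intro equalityI subsetI)
    fix f assume f: "f \<in> hilb k"
    show "f \<in> (\<lambda>f x. f (A *v x)) ` hilb k"
    proof (rule image_eqI)
      show "f = (\<lambda>x. (\<lambda>y. f (B *v y)) (A *v x))" by (simp add: inv')
      show "(\<lambda>y. f (B *v y)) \<in> hilb k"
        using f hilb_iff[of "\<lambda>y. f (B *v y)"] by (simp add: inv')
    qed
  next
    fix f assume "f \<in> (\<lambda>f x. f (A *v x)) ` hilb k"
    then show "f \<in> hilb k" using hilb_iff by auto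
  qed
  have "J_fun M X Y k lam U = (INF f\<in>(\<lambda>f x. f (A *v x)) ` hilb k.
      1/2 * (LINT w|M. (cmod (Y w - f (U *v X w)))\<^sup>2) + lam/2 * hilb_norm_sq k f)"
    unfolding J_fun_def hilb_eq[symmetric] ..
  also have "\<dots> = J_fun M X Y k lam (A ** U)"
    unfolding J_fun_def image_image norm_eq by (simp add: matrix_vector_mul_assoc)
  finally show ?thesis ..
qed

lemma matrix_inv_mult:
  fixes C :: "'a::semiring_1^'n^'n"
  assumes "invertible C"
  shows "C ** matrix_inv C = mat 1" "matrix_inv C ** C = mat 1"
  using someI_ex[OF assms[unfolded invertible_def]] unfolding matrix_inv_def by blast+

text \<open>This makes the choice of \<open>U\<close> in \<open>JJ_fun\<close> immaterial. Factor
  \<open>C\<close> as \<open>transpose R ** R\<close> and let \<open>Z\<close> be the inverse of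
  \<open>transpose R\<close>; then \<open>normV_sq C x\<close> is the squared Euclidean norm of
  \<open>Z *v x\<close>. Equal forms therefore yield an orthogonal \<open>Q\<close> relating
  \<open>Z ** U\<close> and \<open>Z ** U'\<close>, and conjugating \<open>Q\<close> back by
  \<open>Z\<close> gives a rotation \<open>A\<close> of \<open>V\<close> with
  \<open>U = A ** U'\<close>.\<close>

lemma J_fun_cong:
  fixes U U' C :: "real^'n^'n" and k :: "real^'n \<Rightarrow> real"
  assumes sym: "transpose C = C" and pos: "\<And>x. x \<noteq> 0 \<Longrightarrow> 0 < x \<bullet> (C *v x)"
    and km: "k \<in> borel_measurable borel"
    and rot: "\<And>\<omega>. k \<omega> = kr (dual_norm_sq C \<omega>)"
    and eq: "\<And>x. normV_sq C (U *v x) = normV_sq C (U' *v x)"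
  shows "J_fun M X Y k lam U = J_fun M X Y k lam U'"
proof -
  have "0 \<le> x \<bullet> (C *v x)" for x using pos[of x] by (cases "x = 0") auto
  from psd_gram_factor[OF sym this] obtain R :: "real^'n^'n" where R: "C = transpose R ** R" .
  have dual: "dual_norm_sq C \<omega> = (norm (R *v \<omega>))\<^sup>2" for \<omega>
    unfolding dual_norm_sq_def norm_matrix_vector_sq R ..
  have "invertible R"
  proof -
    have "x = 0" if "R *v x = 0" for x
      using dual[of x] pos[of x] that by (auto simp: dual_norm_sq_def)
    then show ?thesis
      by (simp add: invertible_left_inverse matrix_left_invertible_ker)
  qed
  then obtain W where W: "W ** R = mat 1" "R ** W = mat 1"
    unfolding invertible_def by blast
  define Z where "Z = transpose W"
  have Z: "Z ** transpose R = mat 1" "transpose R ** Z = mat 1"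
    using W unfolding Z_def by (simp_all add: matrix_transpose_mul[symmetric])
  have "(transpose Z ** Z) ** C = mat 1" "C ** (transpose Z ** Z) = mat 1"
  proof -
    have "(transpose Z ** Z) ** C = W ** (Z ** transpose R) ** R"
      unfolding R Z_def by (simp add: matrix_mul_assoc)
    then show "(transpose Z ** Z) ** C = mat 1" using Z W by simp
    then show "C ** (transpose Z ** Z) = mat 1" by (simp add: matrix_left_right_inverse)
  qed
  then have "matrix_inv C = transpose Z ** Z"
    by (metis invertible_def matrix_inv_mult(1) matrix_mul_assoc matrix_mul_lid matrix_mul_rid)
  then have nV: "normV_sq C x = (norm (Z *v x))\<^sup>2" for x
    unfolding normV_sq_def norm_matrix_vector_sq by simp
  have "norm ((Z ** U) *v x) = norm ((Z ** U') *v x)" for x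
    using eq[of x] unfolding nV by (simp add: matrix_vector_mul_assoc)
  then obtain Q where Q: "orthogonal_matrix Q" "Z ** U = Q ** (Z ** U')"
    using orthogonal_extension_matrix by blast
  have QQ: "Q ** transpose Q = mat 1" "transpose Q ** Q = mat 1"
    using Q(1) by (auto simp: orthogonal_matrix_def)
  define A where "A = transpose R ** Q ** Z"
  define B where "B = transpose R ** transpose Q ** Z"
  have AB: "A ** B = mat 1"
  proof -
    have "A ** B = transpose R ** (Q ** (Z ** transpose R) ** transpose Q) ** Z"
      unfolding A_def B_def by (simp add: matrix_mul_assoc)
    then show ?thesis by (simp add: Z QQ)
  qed
  have U: "U = A ** U'"
  proof -
    have "A ** U' = transpose R ** (Z ** U)"
      unfolding A_def Q(2) by (simp add: matrix_mul_assoc)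
    then show ?thesis by (simp add: matrix_mul_assoc Z)
  qed
  \<comment> \<open>In the dual coordinates given by \<open>R\<close>, the action of
    \<open>transpose A\<close> is the orthogonal map \<open>transpose Q\<close>, so it preserves the
    dual norm and with it \<open>k\<close>.\<close>
  have RA: "R ** transpose A = transpose Q ** R"
  proof -
    have "R ** transpose A = (R ** W) ** transpose Q ** R"
      unfolding A_def Z_def by (simp add: matrix_transpose_mul matrix_mul_assoc)
    then show ?thesis by (simp add: W)
  qed
  have nR: "norm (R *v (transpose A *v x)) = norm (R *v x)" for x
  proof -
    have "(norm (transpose Q *v y))\<^sup>2 = (norm y)\<^sup>2" for y
      unfolding norm_matrix_vector_sq by (simp add: QQ power2_norm_eq_inner)
    then have "norm (transpose Q *v y) = norm y" for y
      by simp
    then show ?thesis by (metis RA matrix_vector_mul_assoc)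
  qed
  have "k (transpose A *v \<omega>) = k \<omega>" for \<omega>
    unfolding rot dual nR ..
  moreover have "distr lborel borel ((*v) (transpose A)) = lborel"
  proof (rule distr_lborel_linear)
    have BA: "transpose A ** transpose B = mat 1"
      using AB by (metis matrix_left_right_inverse matrix_transpose_mul transpose_mat)
    show "transpose A *v (transpose B *v y) = y" for y
      by (simp only: matrix_vector_mul_assoc BA matrix_vector_mul_lid)
    \<comment> \<open>The invariant set is the dual unit ball. As a linear image it is visibly
      compact; as a sublevel set it visibly has interior and is invariant under
      \<open>transpose A\<close>.\<close>
    have E: "(*v) W ` cball 0 1 = {x. norm (R *v x) \<le> 1}"
    proof (intro equalityI subsetI)
      fix x assume "x \<in> {x. norm (R *v x) \<le> 1}"
      then show "x \<in> (*v) W ` cball 0 1"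
        by (intro image_eqI[of _ _ "R *v x"]) (simp_all add: matrix_vector_mul_assoc W)
    qed (auto simp: matrix_vector_mul_assoc W)
    show "compact ((*v) W ` cball 0 1)"
      by (intro compact_continuous_image linear_continuous_on) (simp_all add: linear_linear)
    have "0 \<in> interior {x. norm (R *v x) \<le> 1}"
    proof (rule interiorI)
      show "open {x. norm (R *v x) < 1}"
        by (intro open_Collect_less continuous_intros linear_continuous_on) (simp_all add: linear_linear)
    qed auto
    then show "interior ((*v) W ` cball 0 1) \<noteq> {}" unfolding E by blast
    show "(*v) (transpose A) -` (*v) W ` cball 0 1 = (*v) W ` cball 0 1"
      unfolding E by (simp add: nR vimage_def del: transpose_matrix_vector)
  qed simp
  ultimately show ?thesis
    unfolding U by (intro J_fun_rotate[OF AB _ km])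
qed

section \<open>The covariance matrix\<close>

lemma cov_mat_symmetric: "transpose (cov_mat M X) = cov_mat M X"
  by (simp add: cov_mat_def transpose_def vec_eq_iff mult.commute)

text \<open>Expanding the square under the integral needs each product of centred components to be
  integrable. The eighth moment gives this on a probability space, since a square is at most 1 plus
  the eighth power. The identity converts nondegeneracy of \<open>X\<close> into positive
  definiteness of \<open>C\<close>.\<close>

lemma cov_form_eq:
  fixes X :: "'w \<Rightarrow> real^'n"
  assumes "prob_space M" and Xm[measurable]: "X \<in> borel_measurable M"
    and int: "integrable M (\<lambda>w. norm (X w) ^ 8)"
  shows "cov_form M X \<omega> = \<omega> \<bullet> (cov_mat M X *v \<omega>)"
proof -
  interpret prob_space M by fact
  define m where "m = (LINT v|M. X v)"
  define Z where "Z = (\<lambda>w. X w - m)"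
  have Zm[measurable]: "Z \<in> borel_measurable M" unfolding Z_def by measurable
  have bound: "(norm (Z w))\<^sup>2 \<le> 2 * (1 + norm (X w) ^ 8) + 2 * (norm m)\<^sup>2" for w
  proof -
    have "(norm (Z w))\<^sup>2 \<le> (norm (X w) + norm m)\<^sup>2"
      unfolding Z_def by (intro power_mono norm_triangle_ineq4) simp
    also have "\<dots> \<le> 2 * (norm (X w))\<^sup>2 + 2 * (norm m)\<^sup>2"
      using sum_squares_bound[of "norm (X w)" "norm m"] by (simp add: power2_sum)
    also have "(norm (X w))\<^sup>2 \<le> 1 + norm (X w) ^ 8"
    proof (cases "norm (X w) \<le> 1")
      case True
      then show ?thesis by (simp add: power_le_one add_increasing2)
    next
      case False
      then have "(norm (X w))\<^sup>2 \<le> norm (X w) ^ 8" by (intro power_increasing) auto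
      then show ?thesis by simp
    qed
    finally show ?thesis by simp
  qed
  have intZ: "integrable M (\<lambda>w. Z w $ i * Z w $ j)" for i j
  proof (rule Bochner_Integration.integrable_bound)
    show "integrable M (\<lambda>w. 2 * (1 + norm (X w) ^ 8) + 2 * (norm m)\<^sup>2)"
      using int by simp
    have [measurable]: "(\<lambda>w. Z w $ i) \<in> borel_measurable M" for i
      using borel_measurable_inner[OF Zm borel_measurable_const, of "axis i 1"] by (simp add: inner_axis)
    show "(\<lambda>w. Z w $ i * Z w $ j) \<in> borel_measurable M" by measurable
    show "AE w in M. norm (Z w $ i * Z w $ j) \<le> norm (2 * (1 + norm (X w) ^ 8) + 2 * (norm m)\<^sup>2)"
    proof (rule AE_I2)
      fix w
      have "norm (Z w $ i * Z w $ j) \<le> norm (Z w) * norm (Z w)"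
        unfolding norm_mult by (intro mult_mono) (auto simp: component_le_norm_cart)
      also have "\<dots> \<le> 2 * (1 + norm (X w) ^ 8) + 2 * (norm m)\<^sup>2"
        using bound[of w] by (simp add: power2_eq_square)
      also have "\<dots> \<le> norm (2 * (1 + norm (X w) ^ 8) + 2 * (norm m)\<^sup>2)" by simp
      finally show "norm (Z w $ i * Z w $ j) \<le> norm (2 * (1 + norm (X w) ^ 8) + 2 * (norm m)\<^sup>2)" .
    qed
  qed
  have "cov_form M X \<omega> = (LINT w|M. (\<omega> \<bullet> Z w)\<^sup>2)"
    by (simp add: cov_form_def Z_def m_def)
  also have "\<dots> = (LINT w|M. (\<Sum>i\<in>UNIV. \<Sum>j\<in>UNIV. (\<omega> $ i * \<omega> $ j) * (Z w $ i * Z w $ j)))"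
    by (simp add: inner_vec_def power2_eq_square sum_product mult_ac)
  also have "\<dots> = (\<Sum>i\<in>UNIV. \<Sum>j\<in>UNIV. (\<omega> $ i * \<omega> $ j) * (LINT w|M. Z w $ i * Z w $ j))"
    using intZ by simp
  also have "\<dots> = \<omega> \<bullet> (cov_mat M X *v \<omega>)"
    by (simp add: inner_vec_def cov_mat_def matrix_vector_mult_def sum_distrib_left m_def[symmetric] Z_def mult_ac)
  finally show ?thesis .
qed

section \<open>The trace pairing and the differential of \<open>proj\<close>\<close>

text \<open>\<open>pairing A H\<close> is the trace of \<open>transpose A ** H\<close>, for which
  the adjoint of left multiplication is left multiplication by the transpose.\<close>

lemma pairing_mult_right: "pairing A (B ** H) = pairing (transpose B ** A) H"
proof -
  have "pairing A (B ** H) = (\<Sum>a\<in>UNIV. \<Sum>b\<in>UNIV. \<Sum>c\<in>UNIV. A $ a $ b * B $ a $ c * H $ c $ b)"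
    by (simp add: pairing_def matrix_matrix_mult_def sum_distrib_left mult_ac)
  also have "\<dots> = (\<Sum>a\<in>UNIV. \<Sum>c\<in>UNIV. \<Sum>b\<in>UNIV. A $ a $ b * B $ a $ c * H $ c $ b)"
    by (rule sum.cong[OF refl], rule sum.swap)
  also have "\<dots> = (\<Sum>c\<in>UNIV. \<Sum>a\<in>UNIV. \<Sum>b\<in>UNIV. A $ a $ b * B $ a $ c * H $ c $ b)"
    by (rule sum.swap)
  also have "\<dots> = (\<Sum>c\<in>UNIV. \<Sum>b\<in>UNIV. \<Sum>a\<in>UNIV. A $ a $ b * B $ a $ c * H $ c $ b)"
    by (rule sum.cong[OF refl], rule sum.swap)
  also have "\<dots> = pairing (transpose B ** A) H"
    by (simp add: pairing_def matrix_matrix_mult_def transpose_def sum_distrib_left mult_ac)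
  finally show ?thesis .
qed

lemma pairing_transpose: "pairing A (transpose H) = pairing (transpose A) H"
  unfolding pairing_def transpose_def by simp (rule sum.swap)

lemma pairing_add_right: "pairing A (H + H') = pairing A H + pairing A H'"
  by (simp add: pairing_def distrib_left sum.distrib)

lemma pairing_axis: "pairing A (axis j (axis c 1)) = A $ j $ c"
proof -
  have "pairing A (axis j (axis c 1)) = (\<Sum>a\<in>UNIV. \<Sum>b\<in>UNIV. if a = j then (if b = c then A $ a $ b else 0) else 0)"
    unfolding pairing_def by (intro sum.cong refl) (simp add: axis_def)
  also have "\<dots> = (\<Sum>a\<in>UNIV. if a = j then A $ a $ c else 0)"
    by (intro sum.cong refl) simp
  also have "\<dots> = A $ j $ c" by simp
  finally show ?thesis .
qed

lemma bounded_bilinear_matrix_mult: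
  "bounded_bilinear ((**) :: real^'n^'n \<Rightarrow> real^'n^'n \<Rightarrow> real^'n^'n)"
  unfolding bilinear_conv_bounded_bilinear[symmetric] bilinear_def
  by (auto intro!: linearI simp: matrix_matrix_mult_def vec_eq_iff algebra_simps
      sum.distrib sum_distrib_left)

lemma bounded_linear_transpose: "bounded_linear (transpose :: real^'n^'n \<Rightarrow> real^'n^'n)"
  unfolding linear_conv_bounded_linear[symmetric]
  by (auto intro!: linearI simp: transpose_def vec_eq_iff)

text \<open>Serves twice: with \<open>U\<close> the identity on endomorphisms, for the differential
  of \<open>J\<close>, and with \<open>U\<close> a solution curve, for the flow.\<close>

lemma proj_has_derivative:
  assumes U: "(U has_derivative U') (at t within I)"
  shows "((\<lambda>t. proj C (U t)) has_derivative
    (\<lambda>h. transpose (U t) ** matrix_inv C ** U' h + transpose (U' h) ** matrix_inv C ** U t)) (at t within I)"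
proof -
  interpret mm: bounded_bilinear "(**) :: real^'n^'n \<Rightarrow> real^'n^'n \<Rightarrow> real^'n^'n"
    by (rule bounded_bilinear_matrix_mult)
  note dT = bounded_linear.has_derivative[OF bounded_linear_transpose U]
  note dTG = bounded_linear.has_derivative[OF mm.bounded_linear_left[of "matrix_inv C"] dT]
  show ?thesis
    unfolding proj_def using mm.FDERIV[OF dTG U] .
qed

section \<open>Factorization of \<open>J\<close> through \<open>proj\<close> and the chain
  rule\<close>

lemma inner_proj: "x \<bullet> (proj C U *v x) = normV_sq C (U *v x)"
  unfolding proj_def normV_sq_def
  by (simp add: matrix_vector_mul_assoc[symmetric] inner_commute[of x] inner_commute[of "U *v x"] dot_lmul_matrix)

lemma proj_in_Sym_ge0:
  assumes "transpose (matrix_inv C) = matrix_inv C" "\<And>x. 0 \<le> normV_sq C x"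
  shows "proj C U \<in> Sym_ge0"
  using assms by (simp add: Sym_ge0_def inner_proj) (simp add: proj_def matrix_transpose_mul matrix_mul_assoc)

text \<open>\<open>U\<close> itself witnesses the choice in \<open>JJ_fun\<close>, so the chosen
  endomorphism induces the same form as \<open>U\<close> and has the same value of
  \<open>J\<close>.\<close>

lemma JJ_fun_proj:
  fixes U C :: "real^'n^'n" and k :: "real^'n \<Rightarrow> real"
  assumes "C = cov_mat M X" and "\<And>x. x \<noteq> 0 \<Longrightarrow> 0 < x \<bullet> (C *v x)"
    and "k \<in> borel_measurable borel" and "\<And>\<omega>. k \<omega> = kr (dual_norm_sq C \<omega>)"
  shows "JJ_fun M X Y k lam (proj C U) = J_fun M X Y k lam U"
proof -
  define U' where "U' = (SOME U'. \<forall>x. x \<bullet> (proj C U *v x) = normV_sq C (U' *v x))"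
  have "\<forall>x. x \<bullet> (proj C U *v x) = normV_sq C (U' *v x)"
    unfolding U'_def by (rule someI[of _ U]) (simp add: inner_proj)
  then have "J_fun M X Y k lam U' = J_fun M X Y k lam U"
    using assms cov_mat_symmetric[of M X] by (intro J_fun_cong[of C k kr]) (auto simp: inner_proj)
  then show ?thesis unfolding JJ_fun_def U'_def assms(1) .
qed

text \<open>\<open>F\<close> is differentiable only within \<open>S\<close>, but
  \<open>proj C\<close> maps every endomorphism into \<open>S\<close>, so the composite is
  differentiable on the full space. The two terms of the differential of \<open>proj\<close> are
  transposes of each other and contribute equally against the symmetric \<open>A\<close>, whence the
  factor 2.\<close>

lemma D_comp_proj_compose:
  fixes C :: "real^'n^'n"
  assumes symG: "transpose (matrix_inv C) = matrix_inv C"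
    and symA: "transpose A = A"
    and F: "(F has_derivative pairing A) (at (proj C U) within S)"
    and S: "\<And>U. proj C U \<in> S"
    and FJ: "\<And>U. F (proj C U) = J U"
  shows "D_comp J U c j = 2 * (matrix_inv C ** U ** A) $ j $ c"
proof -
  let ?G = "matrix_inv C"
  have "((\<lambda>U. F (proj C U)) has_derivative
      (\<lambda>H. pairing A (transpose U ** ?G ** H + transpose H ** ?G ** U))) (at U)"
    by (intro has_derivative_in_compose[OF proj_has_derivative[OF has_derivative_ident]]
        has_derivative_subset[OF F]) (use S in blast)
  moreover have "pairing A (transpose U ** ?G ** H + transpose H ** ?G ** U) = 2 * pairing (?G ** U ** A) H" for H
  proof -
    have "transpose H ** ?G ** U = transpose (transpose U ** ?G ** H)"
      by (simp add: matrix_transpose_mul symG matrix_mul_assoc)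
    then have "pairing A (transpose H ** ?G ** U) = pairing A (transpose U ** ?G ** H)"
      by (simp only: pairing_transpose symA)
    then show ?thesis
      by (simp add: pairing_add_right pairing_mult_right matrix_transpose_mul symG)
  qed
  ultimately have "(J has_derivative (\<lambda>H. 2 * pairing (?G ** U ** A) H)) (at U)"
    by (simp add: FJ)
  then have "frechet_derivative J (at U) = (\<lambda>H. 2 * pairing (?G ** U ** A) H)"
    by (rule frechet_derivative_at[symmetric])
  then show ?thesis by (simp add: D_comp_def pairing_axis)
qed

section \<open>The two vector fields in matrix form\<close>

lemma matrix_mult3_nth:
  "(P ** Q ** R) $ a $ b = (\<Sum>c\<in>UNIV. \<Sum>d\<in>UNIV. P $ a $ c * Q $ c $ d * R $ d $ b)"
  for P :: "'a::semiring_1^'m^'n"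
  unfolding matrix_mul_assoc[symmetric]
  by (simp add: matrix_matrix_mult_def sum_distrib_left mult.assoc)

lemma riem_field_matrix:
  assumes "transpose S = S" "transpose (matrix_inv C) = matrix_inv C"
  shows "riem_field C S A = (- (1/2)) *\<^sub>R (S ** A ** matrix_inv C + matrix_inv C ** A ** S)"
proof -
  have s: "S $ i $ j = S $ j $ i" "matrix_inv C $ i $ j = matrix_inv C $ j $ i" for i j
    using assms[THEN arg_cong[where f = "\<lambda>B. B $ i $ j"]] by (simp_all add: transpose_def)
  have "(S ** A ** matrix_inv C) $ a $ b = (\<Sum>c\<in>UNIV. \<Sum>d\<in>UNIV. S $ a $ c * matrix_inv C $ b $ d * A $ c $ d)" for a b
    unfolding matrix_mult3_nth by (intro sum.cong refl) (simp add: s(2)[of b] mult_ac)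
  moreover have "(matrix_inv C ** A ** S) $ a $ b = (\<Sum>c\<in>UNIV. \<Sum>d\<in>UNIV. S $ b $ d * matrix_inv C $ a $ c * A $ c $ d)" for a b
    unfolding matrix_mult3_nth by (intro sum.cong refl) (simp add: s(1)[of b] mult_ac)
  ultimately show ?thesis
    by (simp add: riem_field_def vec_eq_iff sum.distrib)
qed

text \<open>The factor \<open>C\<close> of the flow cancels the \<open>matrix_inv C\<close> on the
  left of the differential, the remaining \<open>matrix_inv C\<close> multiplies on the right, and
  the factor 2 turns 1/4 into 1/2.\<close>

lemma euclid_field_matrix:
  fixes C U A :: "real^'n^'n"
  assumes C: "C ** matrix_inv C = mat 1" and symG: "transpose (matrix_inv C) = matrix_inv C"
    and D: "\<And>c j. D c j = 2 * (matrix_inv C ** U ** A) $ j $ c"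
  shows "(\<chi> i a. - (1/4) * (\<Sum>c\<in>UNIV. \<Sum>j\<in>UNIV. matrix_inv C $ a $ c * C $ i $ j * D c j))
    = (- (1/2)) *\<^sub>R (U ** A ** matrix_inv C)"
proof -
  let ?G = "matrix_inv C"
  have s: "?G $ i $ j = ?G $ j $ i" for i j
    using symG[THEN arg_cong[where f = "\<lambda>B. B $ i $ j"]] by (simp add: transpose_def)
  have "(U ** A ** ?G) $ i $ a = (\<Sum>c\<in>UNIV. \<Sum>j\<in>UNIV. ?G $ a $ c * C $ i $ j * (?G ** U ** A) $ j $ c)" for i a
  proof -
    have "U ** A ** ?G = C ** (?G ** U ** A) ** ?G"
      by (simp add: matrix_mul_assoc C)
    also have "\<dots> $ i $ a = (\<Sum>j\<in>UNIV. \<Sum>c\<in>UNIV. ?G $ a $ c * C $ i $ j * (?G ** U ** A) $ j $ c)"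
      unfolding matrix_mult3_nth[of C] by (intro sum.cong refl) (simp add: s[of a] mult_ac)
    finally show ?thesis by (rule trans[OF _ sum.swap])
  qed
  then show ?thesis
    by (simp add: vec_eq_iff D sum_distrib_left sum_negf mult_ac)
qed

section \<open>The lifted flow\<close>

theorem theorem1p1:
  fixes M :: "'w measure" and X :: "'w \<Rightarrow> real ^ 'n" and Y :: "'w \<Rightarrow> complex"
    and lam :: real and C :: "real ^ 'n ^ 'n"
    and k :: "real ^ 'n \<Rightarrow> real" and kr KK KK' KK'' :: "real \<Rightarrow> real"
    and DJJ :: "real ^ 'n ^ 'n \<Rightarrow> real ^ 'n ^ 'n"
    and I :: "real set" and U :: "real \<Rightarrow> real ^ 'n ^ 'n"
  assumes "prob_space M"
    and "X \<in> borel_measurable M" and "Y \<in> borel_measurable M"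
    and "integrable M (\<lambda>w. (cmod (Y w))\<^sup>2)" and "integrable M (\<lambda>w. norm (X w) ^ 8)"
    and "lam > 0"
    and cov_pos: "\<And>\<omega>. \<omega> \<noteq> 0 \<Longrightarrow> cov_form M X \<omega> > 0"
    and C_def: "C = cov_mat M X"
    and "\<And>\<omega>. k \<omega> > 0"
    and rot_inv: "\<And>\<omega>. k \<omega> = kr (dual_norm_sq C \<omega>)"
    and "integrable lborel k" and "(LINT \<omega>|lborel. k \<omega>) = 1"
    and "\<And>x. fourier_synth (\<lambda>\<omega>. complex_of_real (k \<omega>)) x = complex_of_real (KK (normV_sq C x))"
    and "\<And>r. r \<ge> 0 \<Longrightarrow> (KK has_real_derivative KK' r) (at r within {0..})"
    and "\<And>r. r \<ge> 0 \<Longrightarrow> (KK' has_real_derivative KK'' r) (at r within {0..})"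
    and "continuous_on {0..} KK'" and "continuous_on {0..} KK''"
    and "bounded (KK' ` {0..})" and "bounded (KK'' ` {0..})"
    and "\<exists>R B. \<forall>r\<ge>R. \<bar>r * KK' r\<bar> \<le> B"
    and DJJ: "C1_differential (JJ_fun M X Y k lam) DJJ"
    and "is_interval I"
    and flow: "euclid_flow C (J_fun M X Y k lam) I U"
  shows "riem_flow C DJJ I (\<lambda>t. proj C (U t))"
proof -
  let ?J = "J_fun M X Y k lam" and ?G = "matrix_inv C"
  have posC: "0 < x \<bullet> (C *v x)" if "x \<noteq> 0" for x
    using cov_pos[OF that] cov_form_eq[OF assms(1,2,5)] by (simp add: C_def)
  have symC: "transpose C = C"
    by (simp add: C_def cov_mat_symmetric)
  have "x = 0" if "C *v x = 0" for x
    using posC[of x] that by auto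
  then have "invertible C"
    by (simp add: invertible_left_inverse matrix_left_invertible_ker)
  then have CG: "C ** ?G = mat 1" "?G ** C = mat 1"
    by (simp_all add: matrix_inv_mult)
  have symG: "transpose ?G = ?G"
  proof -
    have "transpose ?G = transpose ?G ** (C ** ?G)" by (simp add: CG)
    also have "\<dots> = transpose (C ** ?G) ** ?G"
      by (simp only: matrix_transpose_mul symC matrix_mul_assoc)
    also have "\<dots> = ?G" by (simp add: CG)
    finally show ?thesis .
  qed
  have "0 \<le> normV_sq C x" for x
  proof -
    \<comment> \<open>Nonnegativity passes from \<open>C\<close> to its inverse by evaluating the
      form of \<open>C\<close> at \<open>?G *v x\<close>.\<close>
    have "x = C *v (?G *v x)" by (simp add: matrix_vector_mul_assoc CG)
    then have "normV_sq C x = (?G *v x) \<bullet> (C *v (?G *v x))"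
      by (metis inner_commute normV_sq_def)
    then show ?thesis
      using posC[of "?G *v x"] by (cases "?G *v x = 0") auto
  qed
  then have Sym: "proj C V \<in> Sym_ge0" for V
    by (rule proj_in_Sym_ge0[OF symG])
  have km: "k \<in> borel_measurable borel"
    using borel_measurable_integrable[OF assms(11)] by simp
  show ?thesis
    unfolding riem_flow_def
  proof (intro ballI conjI Sym)
    fix t assume t: "t \<in> I"
    let ?S = "proj C (U t)"
    let ?A = "DJJ ?S"
    have symS: "transpose ?S = ?S" using Sym[of "U t"] by (simp add: Sym_ge0_def)
    have symA: "transpose ?A = ?A"
      and der: "(JJ_fun M X Y k lam has_derivative pairing ?A) (at ?S within Sym_ge0)"
      using DJJ Sym[of "U t"] by (auto simp: C1_differential_def)
    have "D_comp ?J (U t) c j = 2 * (?G ** U t ** ?A) $ j $ c" for c j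
      by (rule D_comp_proj_compose[OF symG symA der Sym JJ_fun_proj[OF C_def posC km rot_inv]])
    note field = euclid_field_matrix[OF CG(1) symG this]
    let ?V = "(- (1/2)) *\<^sub>R (U t ** ?A ** ?G)"
    have "(U has_vector_derivative ?V) (at t within I)"
      using bspec[OF flow[unfolded euclid_flow_def] t] unfolding field .
    then have "((\<lambda>t. proj C (U t)) has_derivative
        (\<lambda>h. transpose (U t) ** ?G ** (h *\<^sub>R ?V) + transpose (h *\<^sub>R ?V) ** ?G ** U t)) (at t within I)"
      unfolding has_vector_derivative_def by (rule proj_has_derivative)
    \<comment> \<open>Apart from \<open>h\<close> and the factor -1/2, the first term is
      \<open>?S ** ?A ** ?G\<close> and, by symmetry of \<open>?A\<close> and \<open>?G\<close>, the
      second is \<open>?G ** ?A ** ?S\<close>: the two halves of the Riemannian field.\<close>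
    moreover have "transpose (U t) ** ?G ** (h *\<^sub>R ?V) + transpose (h *\<^sub>R ?V) ** ?G ** U t
        = h *\<^sub>R riem_field C ?S ?A" for h
    proof -
      interpret mm: bounded_bilinear "(**) :: real^'n^'n \<Rightarrow> real^'n^'n \<Rightarrow> real^'n^'n"
        by (rule bounded_bilinear_matrix_mult)
      have lT: "linear (transpose :: real^'n^'n \<Rightarrow> real^'n^'n)"
        using bounded_linear_transpose by (rule bounded_linear.linear)
      have "transpose (h *\<^sub>R ?V) = (h * (- (1/2))) *\<^sub>R (?G ** ?A ** transpose (U t))"
        by (simp add: linear_scale[OF lT] linear_neg[OF lT]
            matrix_transpose_mul symG symA matrix_mul_assoc)
      then show ?thesis
        unfolding riem_field_matrix[OF symS symG]
        by (simp add: proj_def mm.scaleR_left mm.scaleR_right mm.minus_left mm.minus_right matrix_mul_assoc scaleR_add_right scaleR_diff_right)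
    qed
    ultimately show "((\<lambda>t. proj C (U t)) has_vector_derivative riem_field C ?S ?A) (at t within I)"
      by (simp add: has_vector_derivative_def)
  qed
qed

end
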